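(* Let $(g_t)_{t\ge0}$ be a family of holomorphic functions in $\mathbb{D}$. Suppose that the following conditions hold: (i) the map $\mathbb{D}\times[0,+\infty)\ni(z,t)\mapsto g_t(z)$ is continuous and for each $z\in\mathbb{D}$ the map $[0,+\infty)\ni t\mapsto g_t(z)$ is locally absolutely continuous; (ii) there exists a Herglotz vector field $G:\mathbb{D}\times[0,+\infty)\to\mathbb{C}$ such that for every $z\in\mathbb{D}$, $$\frac{\partial g_t(z)}{\partial t}=-g_t'(z)G(z,t)\quad\text{for a.e. } t\ge0;$$ (iii) the Loewner range $\bigcup_{t\ge0}f_t(\mathbb{D})$ of some (and hence any) Loewner chain $(f_t)$ associated with $G$ coincides with $\mathbb{C}$; (iv) the family $(g_t)$ is uniformly locally univalent in $\mathbb{D}$. Then $(g_t)$ is a Loewner chain associated with the Herglotz vector field $G$.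
   Context: $\mathbb{D}:=\{z\in\mathbb{C}:|z|<1\}$. An infinitesimal generator in $\mathbb{D}$ is a holomorphic function $\mathbb{D}\to\mathbb{C}$ of the form $z\mapsto(\tau-z)(1-\overline{\tau}z)q(z)$ with $\tau\in\overline{\mathbb{D}}$ and $q:\mathbb{D}\to\mathbb{C}$ holomorphic, $\operatorname{Re}q\ge0$. A Herglotz vector field in $\mathbb{D}$ is $G:\mathbb{D}\times[0,+\infty)\to\mathbb{C}$ such that: (H1) $t\mapsto G(z,t)$ is measurable for each $z\in\mathbb{D}$; (H2) for each compact $K\subset\mathbb{D}$ there is a non-negative locally integrable $k_K:[0,+\infty)\to\mathbb{R}$ with $|G(z,t)|\le k_K(t)$ for all $z\in K$ and a.e. $t\ge0$; (H3) for a.e. $t\ge0$, $G(\cdot,t)$ is an infinitesimal generator. The evolution family of $G$ is the unique family $(\varphi_{s,t})_{0\le s\le t}$ of holomorphic self-maps of $\mathbb{D}$ such that, for all $s\ge0$, $z\in\mathbb{D}$, $w(t)=\varphi_{s,t}(z)$, $t\ge s$, is the (locally absolutely continuous, Carathéodory) solution of $w'(t)=G(w(t),t)$ a.e., $w(s)=z$. A Loewner chain in $\mathbb{D}$ is a family $(f_t)_{t\ge0}$ of univalent holomorphic functions $f_t:\mathbb{D}\to\mathbb{C}$ with $f_s(\mathbb{D})\subset f_t(\mathbb{D})$ for $0\le s<t$, and such that for each compact $K\subset\mathbb{D}$ there is a non-negative locally integrable $k_K$ on $[0,+\infty)$ with $|f_s(z)-f_t(z)|\le\int_s^tk_K(\xi)\,d\xi$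 for $z\in K$, $0\le s\le t$. It is associated with $G$ if $f_t^{-1}\circ f_s=\varphi_{s,t}$ for all $0\le s\le t$, where $(\varphi_{s,t})$ is the evolution family of $G$. Such chains exist and are unique up to post-composition with conformal maps of $\bigcup_{t\ge0}f_t(\mathbb{D})$. A family $\mathcal{F}$ of functions on $\mathbb{D}$ is uniformly locally univalent in $\mathbb{D}$ if there exists $\rho>0$ such that every $f\in\mathcal{F}$ is univalent in every hyperbolic disk (ball for the hyperbolic distance of $\mathbb{D}$) of radius $\rho$ in $\mathbb{D}$. *)

theory Defs
  imports "HOL-Complex_Analysis.Complex_Analysis"
begin

abbreviation unit_disk :: "complex set" where
  "unit_disk \<equiv> ball 0 1"

definition univalent_on :: "(complex \<Rightarrow> complex) \<Rightarrow> complex set \<Rightarrow> bool" where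
  "univalent_on f S \<longleftrightarrow> f holomorphic_on S \<and> inj_on f S"

subsection \<open>Real-variable notions on half-lines\<close>

text \<open>Local integrability on $[0,+\infty)$ with respect to Lebesgue measure; the values of the
  function at negative arguments are irrelevant.\<close>

definition locally_integrable :: "(real \<Rightarrow> real) \<Rightarrow> bool" where
  "locally_integrable k \<longleftrightarrow> (\<forall>T\<ge>0. set_integrable lebesgue {0..T} k)"

text \<open>The usual epsilon-delta definition. A finite family of non-overlapping compact
  subintervals $[\inf J, \sup J]$ of \<open>S\<close> is given as a division of its own union.\<close>

definition abs_cont_on :: "real set \<Rightarrow> (real \<Rightarrow> complex) \<Rightarrow> bool" where
  "abs_cont_on S f \<longleftrightarrow>
     (\<forall>\<epsilon>>0. \<exists>\<delta>>0. \<forall>\<D>. \<D> division_of (\<Union>\<D>) \<and> \<Union>\<D> \<subseteq> S \<and> (\<Sum>J\<in>\<D>. Sup J - Inf J) < \<delta>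
        \<longrightarrow> (\<Sum>J\<in>\<D>. norm (f (Sup J) - f (Inf J))) < \<epsilon>)"

text \<open>Local absolute continuity on the half-line $[s,+\infty)$.\<close>

definition locally_abs_cont_from :: "real \<Rightarrow> (real \<Rightarrow> complex) \<Rightarrow> bool" where
  "locally_abs_cont_from s f \<longleftrightarrow> (\<forall>T\<ge>s. abs_cont_on {s..T} f)"

subsection \<open>Herglotz vector fields and evolution families\<close>

definition infinitesimal_generator :: "(complex \<Rightarrow> complex) \<Rightarrow> bool" where
  "infinitesimal_generator p \<longleftrightarrow>
     (\<exists>\<tau> q. norm \<tau> \<le> 1 \<and> q holomorphic_on unit_disk \<and> (\<forall>z\<in>unit_disk. Re (q z) \<ge> 0) \<and>
        (\<forall>z\<in>unit_disk. p z = (\<tau> - z) * (1 - cnj \<tau> * z) * q z))"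

text \<open>In the second clause the exceptional null set may depend on the point \<open>z\<close>. Because of
  the third clause (continuity in \<open>z\<close> for almost every \<open>t\<close>) this is equivalent to requiring one
  null set for all \<open>z \<in> K\<close>.\<close>

definition herglotz_vector_field :: "(complex \<Rightarrow> real \<Rightarrow> complex) \<Rightarrow> bool" where
  "herglotz_vector_field G \<longleftrightarrow>
     (\<forall>z\<in>unit_disk. (\<lambda>t. G z t) \<in> borel_measurable (lebesgue_on {0..})) \<and>
     (\<forall>K. compact K \<and> K \<subseteq> unit_disk \<longrightarrow>
        (\<exists>k. (\<forall>t\<ge>0. k t \<ge> 0) \<and> locally_integrable k \<and>
             (\<forall>z\<in>K. AE t in lebesgue_on {0..}. norm (G z t) \<le> k t))) \<and>
     (AE t in lebesgue_on {0..}. infinitesimal_generator (\<lambda>z. G z t))"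

text \<open>Only the values \<open>\<phi> s t z\<close> with \<open>0 \<le> s \<le> t\<close> and \<open>z \<in> unit_disk\<close> matter; they are the ones
  uniquely determined by \<open>G\<close>.\<close>

definition evolution_family_of ::
    "(complex \<Rightarrow> real \<Rightarrow> complex) \<Rightarrow> (real \<Rightarrow> real \<Rightarrow> complex \<Rightarrow> complex) \<Rightarrow> bool" where
  "evolution_family_of G \<phi> \<longleftrightarrow>
     (\<forall>s t. 0 \<le> s \<and> s \<le> t \<longrightarrow> \<phi> s t holomorphic_on unit_disk \<and> \<phi> s t ` unit_disk \<subseteq> unit_disk) \<and>
     (\<forall>s\<ge>0. \<forall>z\<in>unit_disk.
        \<phi> s s z = z \<and>
        locally_abs_cont_from s (\<lambda>t. \<phi> s t z) \<and>
        (AE t in lebesgue_on {s..}.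
           ((\<lambda>t. \<phi> s t z) has_vector_derivative G (\<phi> s t z) t) (at t within {s..})))"

subsection \<open>Loewner chains\<close>

definition loewner_chain :: "(real \<Rightarrow> complex \<Rightarrow> complex) \<Rightarrow> bool" where
  "loewner_chain f \<longleftrightarrow>
     (\<forall>t\<ge>0. univalent_on (f t) unit_disk) \<and>
     (\<forall>s t. 0 \<le> s \<and> s < t \<longrightarrow> f s ` unit_disk \<subseteq> f t ` unit_disk) \<and>
     (\<forall>K. compact K \<and> K \<subseteq> unit_disk \<longrightarrow>
        (\<exists>k. (\<forall>t\<ge>0. k t \<ge> 0) \<and> locally_integrable k \<and>
             (\<forall>z\<in>K. \<forall>s t. 0 \<le> s \<and> s \<le> t \<longrightarrow>
                norm (f s z - f t z) \<le> (LINT \<xi>:{s..t}|lebesgue. k \<xi>))))"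

definition loewner_chain_of ::
    "(complex \<Rightarrow> real \<Rightarrow> complex) \<Rightarrow> (real \<Rightarrow> complex \<Rightarrow> complex) \<Rightarrow> bool" where
  "loewner_chain_of G f \<longleftrightarrow>
     loewner_chain f \<and>
     (\<exists>\<phi>. evolution_family_of G \<phi> \<and>
        (\<forall>s t. 0 \<le> s \<and> s \<le> t \<longrightarrow>
           (\<forall>z\<in>unit_disk. inv_into unit_disk (f t) (f s z) = \<phi> s t z)))"

definition loewner_range :: "(real \<Rightarrow> complex \<Rightarrow> complex) \<Rightarrow> complex set" where
  "loewner_range f = (\<Union>t\<in>{0..}. f t ` unit_disk)"

subsection \<open>Uniform local univalence\<close>

text \<open>Normalised to curvature $-1$, i.e. to the density $2/(1-|z|^2)$. Another normalisation only
  rescales the distance, which does not affect uniform local univalence.\<close>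

definition hyp_dist :: "complex \<Rightarrow> complex \<Rightarrow> real" where
  "hyp_dist z w = 2 * artanh (norm (Moebius_function 0 w z))"

definition hyp_disk :: "complex \<Rightarrow> real \<Rightarrow> complex set" where
  "hyp_disk z \<rho> = {w \<in> unit_disk. hyp_dist z w < \<rho>}"

definition uniformly_locally_univalent :: "(complex \<Rightarrow> complex) set \<Rightarrow> bool" where
  "uniformly_locally_univalent \<F> \<longleftrightarrow>
     (\<exists>\<rho>>0. \<forall>f\<in>\<F>. \<forall>z\<in>unit_disk. univalent_on f (hyp_disk z \<rho>))"

end

theory Submission
  imports Defs
begin

text \<open>Let \<open>f\<close> be a Loewner chain of \<open>G\<close> with range \<open>\<complex>\<close> and \<open>\<phi>\<close> the evolution family of \<open>G\<close>. The
  partial differential equation for \<open>g\<close> says that \<open>t \<mapsto> g t (w t)\<close> has derivative \<open>0\<close> along every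
  trajectory \<open>w\<close> of \<open>G\<close>. Hence \<open>g t \<circ> \<phi> s t = g s\<close>, and since also \<open>f t \<circ> \<phi> s t = f s\<close>, the
  functions \<open>g t \<circ> (f t)\<^sup>-\<^sup>1\<close> on the increasing domains \<open>f t ` unit_disk\<close> fit together to one entire
  function \<open>F\<close> with \<open>g t = F \<circ> f t\<close> for all \<open>t\<close>.

  This \<open>F\<close> is injective. Given \<open>a\<close> and \<open>b\<close>, the image \<open>f t ` unit_disk\<close> contains the ball of any
  prescribed radius \<open>R\<close> about \<open>a\<close> once \<open>t\<close> is large. By the Schwarz-Pick lemma the preimages of \<open>a\<close>
  and \<open>b\<close> under \<open>f t\<close> are then at a hyperbolic distance that tends to \<open>0\<close> as \<open>R\<close> grows
  (\<open>hyp_disk_contains_preimages\<close>), so both lie in one hyperbolic disk on which \<open>g t\<close> is univalent.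
  An injective entire function is affine (\<open>injective_entire_imp_affine\<close>), so that
  \<open>g t = \<alpha> + \<beta> * f t\<close> with \<open>\<beta> \<noteq> 0\<close>, and every property of the chain \<open>f\<close> passes to \<open>g\<close>.

  The analytic difficulty is the identity \<open>g t \<circ> \<phi> s t = g s\<close>
  (\<open>first_integral_of_transport_equation\<close>): the null set outside which the equation holds depends
  on the point \<open>z\<close>, so the chain rule cannot be applied along a moving point \<open>w t\<close>. Instead, the
  increment of \<open>t \<mapsto> g t (w t)\<close> over a short interval \<open>{x..y}\<close> is compared with increments in which
  the point is frozen at \<open>w y\<close> and the derivative at \<open>deriv (g x) (w x)\<close>. The frozen increments are
  integrals of their almost everywhere derivatives
  (\<open>fundamental_theorem_of_calculus_abs_cont\<close>), the integrands nearly cancel, and what remains is at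
  most \<open>\<epsilon>\<close> times the integral of a fixed integrable function over \<open>{x..y}\<close>. Summing over a fine
  partition gives an increment that is arbitrarily small.\<close>

section \<open>Absolute continuity and almost everywhere bounds\<close>

lemma abs_cont_on_subset: "abs_cont_on S f \<Longrightarrow> T \<subseteq> S \<Longrightarrow> abs_cont_on T f"
  unfolding abs_cont_on_def by (meson subset_trans)

lemma abs_cont_on_imp_continuous_on:
  assumes "abs_cont_on {a..b} f"
  shows "continuous_on {a..b} f"
  unfolding continuous_on_iff
proof (intro ballI allI impI)
  fix x e :: real assume x: "x \<in> {a..b}" and "e > 0"
  then obtain \<delta> where "\<delta> > 0" and \<delta>: "\<And>\<D>. \<lbrakk>\<D> division_of (\<Union>\<D>); \<Union>\<D> \<subseteq> {a..b}; (\<Sum>J\<in>\<D>. Sup J - Inf J) < \<delta>\<rbrakk>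
        \<Longrightarrow> (\<Sum>J\<in>\<D>. norm (f (Sup J) - f (Inf J))) < e"
    using assms unfolding abs_cont_on_def by meson
  have *: "norm (f v - f u) < e" if "u \<in> {a..b}" "v \<in> {a..b}" "u \<le> v" "v - u < \<delta>" for u v
  proof -
    have "{{u..v}} division_of \<Union>{{u..v}}"
      using division_of_self[of u v] that(3) by simp
    moreover have "\<Union>{{u..v}} \<subseteq> {a..b}" using that by simp
    ultimately have "(\<Sum>J\<in>{{u..v}}. norm (f (Sup J) - f (Inf J))) < e"
      by (rule \<delta>) (use that in simp)
    then show ?thesis using that(3) by simp
  qed
  have "dist (f x') (f x) < e" if "x' \<in> {a..b}" "dist x' x < \<delta>" for x'
  proof (cases "x \<le> x'")
    case True
    then show ?thesis using *[of x x'] x that by (simp add: dist_norm)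
  next
    case False
    then show ?thesis using *[of x' x] x that by (simp add: dist_norm norm_minus_commute)
  qed
  with \<open>\<delta> > 0\<close> show "\<exists>d>0. \<forall>x'\<in>{a..b}. dist x' x < d \<longrightarrow> dist (f x') (f x) < e" by blast
qed

text \<open>Take the integrand to be \<open>0\<close> on the exceptional set \<open>N\<close>. For a fine tagged division, the intervals
  with a tag outside \<open>N\<close> contribute a small error because \<open>f\<close> is differentiable at the tag. The
  intervals with a tag in \<open>N\<close> can be forced into an open set of small measure, hence have small
  total length, and absolute continuity bounds the total increment of \<open>f\<close> over them.\<close>

lemma fundamental_theorem_of_calculus_abs_cont:
  fixes f f' :: "real \<Rightarrow> complex"
  assumes "a \<le> b" and ac: "abs_cont_on {a..b} f" and N: "negligible N"
    and vecd: "\<And>x. x \<in> {a..b} - N \<Longrightarrow> (f has_vector_derivative f' x) (at x within {a..b})"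
  shows "(f' has_integral (f b - f a)) {a..b}"
proof (cases "a = b")
  case True
  then show ?thesis by auto
next
  case False
  with \<open>a \<le> b\<close> have "a < b" by simp
  define F where "F = (\<lambda>x. if x \<in> N then 0 else f' x)"
  have "(F has_integral (f b - f a)) (cbox a b)"
    unfolding has_integral_factor_content
  proof safe
    fix e :: real
    assume "e > 0"
    have "\<forall>x. \<exists>d>0. x \<in> {a..b} - N \<longrightarrow>
         (\<forall>y\<in>{a..b}. norm (y-x) < d \<longrightarrow> norm (f y - f x - (y-x) *\<^sub>R f' x) \<le> (e/2) * norm (y-x))"
    proof
      fix x
      show "\<exists>d>0. x \<in> {a..b} - N \<longrightarrow>
         (\<forall>y\<in>{a..b}. norm (y-x) < d \<longrightarrow> norm (f y - f x - (y-x) *\<^sub>R f' x) \<le> (e/2) * norm (y-x))"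
      proof (cases "x \<in> {a..b} - N")
        case True
        from vecd[OF this] \<open>e > 0\<close> show ?thesis
          unfolding has_vector_derivative_def has_derivative_within_alt
          by (metis half_gt_zero_iff)
      next
        case False
        then show ?thesis by (auto intro: exI[of _ 1])
      qed
    qed
    then obtain d where d: "\<And>x. 0 < d x"
      "\<And>x y. \<lbrakk>x \<in> {a..b}; x \<notin> N; y \<in> {a..b}; norm (y-x) < d x\<rbrakk>
          \<Longrightarrow> norm (f y - f x - (y-x) *\<^sub>R f' x) \<le> (e/2) * norm (y-x)"
      by (metis Diff_iff)
    have "e / 2 * (b - a) > 0" using \<open>e > 0\<close> \<open>a < b\<close> by simp
    then obtain \<delta> where "\<delta> > 0" and \<delta>: "\<And>\<D>. \<lbrakk>\<D> division_of (\<Union>\<D>); \<Union>\<D> \<subseteq> {a..b}; (\<Sum>J\<in>\<D>. Sup J - Inf J) < \<delta>\<rbrakk>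
        \<Longrightarrow> (\<Sum>J\<in>\<D>. norm (f (Sup J) - f (Inf J))) < e / 2 * (b - a)"
      using ac unfolding abs_cont_on_def by meson
    have N': "N \<in> null_sets lebesgue" using N negligible_iff_null_sets by blast
    obtain U where U: "open U" "N \<subseteq> U" "U - N \<in> lmeasurable" "emeasure lebesgue (U - N) < ennreal \<delta>"
      using sets_lebesgue_outer_open[of N \<delta>] N' \<open>\<delta> > 0\<close> by auto
    have UN: "U = (U - N) \<union> N" using U(2) by auto
    have Um: "U \<in> lmeasurable"
      by (subst UN) (intro fmeasurable.Un U(3) negligible_imp_measurable N)
    have "emeasure lebesgue U < ennreal \<delta>"
      by (subst UN, subst emeasure_Un_null_set) (use U N' in \<open>auto simp: fmeasurableD\<close>)
    then have Ume: "measure lebesgue U < \<delta>"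
      using Um \<open>\<delta> > 0\<close> by (simp add: emeasure_eq_measure2 ennreal_less_iff)
    have "\<forall>x. \<exists>r>0. x \<in> N \<longrightarrow> ball x r \<subseteq> U"
      by (metis U(1,2) open_contains_ball subsetD zero_less_one)
    then obtain r where r: "\<And>x. 0 < r x" "\<And>x. x \<in> N \<Longrightarrow> ball x (r x) \<subseteq> U" by metis
    define \<gamma> where "\<gamma> = (\<lambda>x. ball x (if x \<in> N then r x else d x))"
    show "\<exists>\<gamma>. gauge \<gamma> \<and> (\<forall>p. p tagged_division_of (cbox a b) \<and> \<gamma> fine p \<longrightarrow>
      norm ((\<Sum>(x, k)\<in>p. measure lborel k *\<^sub>R F x) - (f b - f a)) \<le> e * measure lborel (cbox a b))"
    proof (rule exI[of _ \<gamma>], safe)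
      show "gauge \<gamma>"
        unfolding \<gamma>_def by (rule gauge_ball_dependent) (use d r in auto)
    next
      fix p
      assume ptag: "p tagged_division_of cbox a b" and finep: "\<gamma> fine p"
      have finp: "finite p" using ptag by blast
      have kk: "\<exists>u v. K = {u..v} \<and> u \<le> v \<and> x \<in> {u..v} \<and> {u..v} \<subseteq> {a..b} \<and> Sup K = v \<and> Inf K = u" 
        if "(x,K) \<in> p" for x K
      proof -
        have "x \<in> K" "K \<subseteq> cbox a b" "\<exists>u v. K = cbox u v"
          using ptag that by (auto simp: tagged_division_of)
        then obtain u v where "K = cbox u v" by blast
        with \<open>x \<in> K\<close> \<open>K \<subseteq> cbox a b\<close> show ?thesis
          by (intro exI[of _ u] exI[of _ v]) auto
      qed
      have ba: "b - a = (\<Sum>(x,K)\<in>p. Sup K - Inf K)" "f b - f a = (\<Sum>(x,K)\<in>p. f(Sup K) - f(Inf K))"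
        using additive_tagged_division_1[where f= "\<lambda>x. x"] additive_tagged_division_1[where f= f]
            \<open>a \<le> b\<close> ptag by auto
      define q where "q = {(x,K) \<in> p. x \<in> N}"
      have qp: "q \<subseteq> p" by (auto simp: q_def)
      have ne: "K \<noteq> {}" if "K \<in> snd ` q" for K
        using kk that by (force simp: q_def)
      have qpart: "q tagged_partial_division_of cbox a b"
        using ptag qp tagged_partial_division_subset unfolding tagged_division_of_def by blast
      have qtag: "q tagged_division_of \<Union>(snd ` q)"
        using tagged_partial_division_of_Union_self[OF qpart] by simp
      have qdiv: "(snd ` q) division_of \<Union>(snd ` q)"
        using partial_division_of_tagged_division[OF qpart] by simp
      \<comment> \<open>absolute continuity on the intervals with a tag in \<open>N\<close>, which all lie in \<open>U\<close>\<close>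
      have "(\<Sum>J\<in>snd ` q. norm (f (Sup J) - f (Inf J))) < e / 2 * (b - a)"
      proof (rule \<delta>[OF qdiv])
        show "\<Union>(snd ` q) \<subseteq> {a..b}"
          using kk qp by fastforce
        have "(\<Sum>J\<in>snd ` q. Sup J - Inf J) = (\<Sum>J\<in>snd ` q. measure lebesgue J)"
        proof (rule sum.cong[OF refl])
          fix J assume "J \<in> snd ` q"
          then obtain x where "(x, J) \<in> p" using qp by auto
          then obtain u v where "J = {u..v}" "u \<le> v" "Sup J = v" "Inf J = u"
            using kk by blast
          then show "Sup J - Inf J = measure lebesgue J" by simp
        qed
        also have "\<dots> = measure lebesgue (\<Union>(snd ` q))"
          using content_division[OF qdiv] by simp
        also have "\<dots> \<le> measure lebesgue U"
        proof (rule measure_mono_fmeasurable)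
          show "\<Union>(snd ` q) \<subseteq> U"
            using finep r(2) by (fastforce simp: q_def fine_def \<gamma>_def)
          show "\<Union>(snd ` q) \<in> sets lebesgue"
            using lmeasurable_division[OF qdiv] by (auto simp: fmeasurableD)
        qed (use Um in auto)
        finally show "(\<Sum>J\<in>snd ` q. Sup J - Inf J) < \<delta>" using Ume by simp
      qed
      moreover have "(\<Sum>(x,K)\<in>q. norm (f (Sup K) - f (Inf K))) = (\<Sum>J\<in>snd ` q. norm (f (Sup J) - f (Inf J)))"
      proof -
        \<comment> \<open>two tags can share an interval only if it is degenerate, and then the increment over it is \<open>0\<close>\<close>
        let ?d = "\<lambda>K. if K = {} then 0 else norm (f (Sup K) - f (Inf K))"
        have "(\<Sum>(x,K)\<in>q. norm (f (Sup K) - f (Inf K))) = (\<Sum>(x,K)\<in>q. ?d K)"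
          by (rule sum.cong) (use ne in force)+
        also have "\<dots> = (\<Sum>K\<in>snd ` q. ?d K)"
          by (rule sum.over_tagged_division_lemma[OF qtag]) auto
        also have "\<dots> = (\<Sum>J\<in>snd ` q. norm (f (Sup J) - f (Inf J)))"
          by (rule sum.cong) (use ne in force)+
        finally show ?thesis .
      qed
      ultimately have qsum: "(\<Sum>(x,K)\<in>q. norm (f (Sup K) - f (Inf K))) \<le> e / 2 * (b - a)" by simp
      have "norm (\<Sum>(x, K) \<in> p. (measure lborel K *\<^sub>R F x) - (f (Sup K) - f (Inf K)))
          \<le> (\<Sum>(x, K)\<in>p. e/2 * (Sup K - Inf K) + (if x \<in> N then norm (f (Sup K) - f (Inf K)) else 0))"
      proof (rule sum_norm_le, safe)
        fix x K
        assume xK: "(x, K) \<in> p"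
        obtain u v where k: "K = {u..v}" "u \<le> v" "x \<in> {u..v}" "{u..v} \<subseteq> {a..b}" "Sup K = v" "Inf K = u"
          using kk[OF xK] by blast
        show "norm (measure lborel K *\<^sub>R F x - (f (Sup K) - f (Inf K)))
           \<le> e/2 * (Sup K - Inf K) + (if x \<in> N then norm (f (Sup K) - f (Inf K)) else 0)"
        proof (cases "x \<in> N")
          case True
          then show ?thesis using k \<open>e > 0\<close> by (simp add: F_def norm_minus_commute)
        next
          case False
          have sub: "K \<subseteq> ball x (d x)"
            using fineD[OF finep xK] False by (simp add: \<gamma>_def)
          have "norm ((v - u) *\<^sub>R f' x - (f v - f u)) = norm (f u - f x - (u - x) *\<^sub>R f' x - (f v - f x - (v - x) *\<^sub>R f' x))"
            by (auto simp: algebra_simps)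
          also have "\<dots> \<le> norm (f u - f x - (u - x) *\<^sub>R f' x) + norm (f v - f x - (v - x) *\<^sub>R f' x)"
            by (rule norm_triangle_ineq4)
          also have "\<dots> \<le> (e/2) * norm (u - x) + (e/2) * norm (v - x)"
          proof (intro add_mono d(2))
            show "norm (u - x) < d x" "norm (v - x) < d x"
              using subsetD[OF sub, of u] subsetD[OF sub, of v] k by (auto simp: dist_real_def)
          qed (use k False in auto)
          also have "\<dots> = e/2 * (v - u)"
            using k by (auto simp: field_simps)
          finally show ?thesis using k False by (simp add: F_def)
        qed
      qed
      also have "\<dots> = e/2 * (b - a) + (\<Sum>(x,K)\<in>q. norm (f (Sup K) - f (Inf K)))"
      proof -
        have "(\<Sum>(x,K)\<in>p. if x \<in> N then norm (f (Sup K) - f (Inf K)) else 0) = (\<Sum>(x,K)\<in>q. norm (f (Sup K) - f (Inf K)))"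
          by (rule sum.mono_neutral_cong_right) (use finp in \<open>auto simp: q_def split: if_splits\<close>)
        then show ?thesis
          by (simp add: split_def sum.distrib ba(1) sum_distrib_left)
      qed
      also have "\<dots> \<le> e * (b - a)"
        using qsum by (simp add: field_simps)
      finally show "norm ((\<Sum>(x, K)\<in>p. measure lborel K *\<^sub>R F x) - (f b - f a)) \<le> e * measure lborel (cbox a b)"
        using \<open>a \<le> b\<close> by (simp add: ba(2) split_def sum_subtractf)
    qed
  qed
  then show ?thesis
    by (intro has_integral_spike[OF N, of _ f' F]) (auto simp: F_def)
qed

lemma has_integral_norm_bound_integral_ae:
  fixes f :: "'n::euclidean_space \<Rightarrow> 'a::banach"
  assumes f: "(f has_integral I) S" and k: "k integrable_on S" and N: "negligible N"
    and le: "\<And>x. x \<in> S - N \<Longrightarrow> norm (f x) \<le> k x"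
  shows "norm I \<le> integral S k"
proof -
  define f0 where "f0 = (\<lambda>x. if x \<in> N then 0 else f x)"
  define k0 where "k0 = (\<lambda>x. if x \<in> N then 0 else k x)"
  have f0: "(f0 has_integral I) S"
    by (rule has_integral_spike[OF N _ f]) (auto simp: f0_def)
  have k0: "(k0 has_integral integral S k) S"
    by (rule has_integral_spike[OF N _ integrable_integral[OF k]]) (auto simp: k0_def)
  have "norm (integral S f0) \<le> integral S k0"
    by (rule integral_norm_bound_integral) (use f0 k0 le in \<open>auto simp: f0_def k0_def\<close>)
  then show ?thesis using f0 k0 by (simp add: integral_unique)
qed

text \<open>The hypothesis is additive over adjacent intervals, so it extends from short intervals to
  \<open>{a..b}\<close> for each \<open>\<epsilon>\<close>, and then \<open>\<epsilon>\<close> tends to \<open>0\<close>.\<close>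

lemma constant_if_locally_small_increments:
  fixes h :: "real \<Rightarrow> 'a::real_normed_vector" and k :: "real \<Rightarrow> real"
  assumes "a \<le> b" and k: "k integrable_on {a..b}"
    and small: "\<And>\<epsilon>. \<epsilon> > 0 \<Longrightarrow> \<exists>\<delta>>0. \<forall>x y. a \<le> x \<and> x \<le> y \<and> y \<le> b \<and> y - x < \<delta>
                  \<longrightarrow> norm (h y - h x) \<le> \<epsilon> * integral {x..y} k"
  shows "h b = h a"
proof -
  have main: "norm (h b - h a) \<le> \<epsilon> * integral {a..b} k" if eps: "\<epsilon> > 0" for \<epsilon>
  proof -
    obtain \<delta> where "\<delta> > 0" and \<delta>: "\<And>x y. \<lbrakk>a \<le> x; x \<le> y; y \<le> b; y - x < \<delta>\<rbrakk>
        \<Longrightarrow> norm (h y - h x) \<le> \<epsilon> * integral {x..y} k"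
      using small[OF eps] by blast
    obtain n :: nat where n: "(b - a) / \<delta> < real n" using reals_Archimedean2 by blast
    have "n > 0" using n \<open>a \<le> b\<close> \<open>\<delta> > 0\<close>
      by (metis divide_nonneg_pos diff_ge_0_iff_ge gr0I not_less of_nat_0)
    define d where "d = (b - a) / real n"
    have d: "0 \<le> d" "d < \<delta>" "a + real n * d = b"
      using n \<open>n > 0\<close> \<open>a \<le> b\<close> \<open>\<delta> > 0\<close> by (auto simp: d_def field_simps)
    have "norm (h (a + real i * d) - h a) \<le> \<epsilon> * integral {a..a + real i * d} k" if "i \<le> n" for i
      using that
    proof (induction i)
      case 0
      then show ?case by simp
    next
      case (Suc i)
      let ?x = "a + real i * d" and ?y = "a + real (Suc i) * d"
      have "real (Suc i) * d \<le> real n * d"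
        using Suc.prems d(1) by (intro mult_right_mono) auto
      then have xy: "a \<le> ?x" "?x \<le> ?y" "?y \<le> b" "?y - ?x < \<delta>"
        using d by (auto simp: algebra_simps)
      have "norm (h ?y - h a) \<le> norm (h ?y - h ?x) + norm (h ?x - h a)"
        using norm_triangle_ineq[of "h ?y - h ?x" "h ?x - h a"] by simp
      also have "\<dots> \<le> \<epsilon> * integral {?x..?y} k + \<epsilon> * integral {a..?x} k"
        using \<delta>[OF xy] Suc by (intro add_mono) auto
      also have "\<dots> = \<epsilon> * integral {a..?y} k"
      proof -
        have "k integrable_on {a..?y}"
          by (rule integrable_subinterval_real[OF k]) (use xy in auto)
        from Henstock_Kurzweil_Integration.integral_combine[OF xy(1,2) this] show ?thesis
          by (simp add: distrib_left[symmetric] add.commute)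
      qed
      finally show ?case .
    qed
    from this[of n] d(3) show ?thesis by simp
  qed
  have "norm (h b - h a) \<le> 0"
  proof (rule field_le_epsilon)
    fix e :: real assume "e > 0"
    define J where "J = \<bar>integral {a..b} k\<bar>"
    have "norm (h b - h a) \<le> e / (J + 1) * integral {a..b} k"
      by (rule main) (use \<open>e > 0\<close> in \<open>auto simp: J_def intro!: divide_pos_pos\<close>)
    also have "\<dots> \<le> e / (J + 1) * (J + 1)"
      by (rule mult_left_mono) (use \<open>e > 0\<close> in \<open>auto simp: J_def\<close>)
    also have "\<dots> = 0 + e" by (simp add: J_def)
    finally show "norm (h b - h a) \<le> 0 + e" .
  qed
  then show ?thesis by simp
qed

lemma AE_halfline_negligible:
  fixes s :: real
  assumes "AE t in lebesgue_on {s..}. P t"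
  obtains N where "negligible N" "\<And>t. t \<ge> s \<Longrightarrow> t \<notin> N \<Longrightarrow> P t"
proof -
  have "{s..} \<in> sets lebesgue" by (intro sets_completionI_sets) auto
  then have "AE t in lebesgue. t \<in> {s..} \<longrightarrow> P t"
    using assms AE_restrict_space_iff[of "{s..}" lebesgue P] by simp
  then obtain N where "N \<in> null_sets lebesgue" "{t. \<not> (t \<in> {s..} \<longrightarrow> P t)} \<subseteq> N"
    unfolding eventually_ae_filter by auto
  then show thesis
    by (intro that[of N]) (auto simp: negligible_iff_null_sets)
qed

section \<open>Locally uniform estimates on the unit disk\<close>

lemma Cauchy_deriv_bound_disk:
  assumes p: "p holomorphic_on unit_disk" and R: "r < R" "R < 1"
    and M: "\<And>z. z \<in> cball 0 R \<Longrightarrow> norm (p z) \<le> M" and z: "z \<in> cball 0 r"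
  shows "norm (deriv p z) \<le> M / (R - r)"
proof -
  have sub: "cball z (R - r) \<subseteq> cball 0 R"
  proof
    fix x assume "x \<in> cball z (R - r)"
    then show "x \<in> cball 0 R"
      using z norm_triangle_ineq2[of x z] by (auto simp: dist_norm norm_minus_commute)
  qed
  have sub1: "cball 0 R \<subseteq> unit_disk" using R by auto
  have "norm ((deriv ^^ 1) p z) \<le> fact 1 * M / (R - r) ^ 1"
  proof (rule Cauchy_inequality)
    show "p holomorphic_on ball z (R - r)"
      by (rule holomorphic_on_subset[OF p]) (use sub sub1 ball_subset_cball in blast)
    show "continuous_on (cball z (R - r)) p"
      by (rule holomorphic_on_imp_continuous_on, rule holomorphic_on_subset[OF p]) (use sub sub1 in blast)
    show "norm (p x) \<le> M" if "norm (z - x) = R - r" for x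
      by (rule M, rule subsetD[OF sub]) (use that in \<open>simp add: dist_norm\<close>)
  qed (use R in auto)
  then show ?thesis by simp
qed

lemma Cauchy_Lipschitz_disk:
  assumes p: "p holomorphic_on unit_disk" and R: "r < R" "R < 1"
    and M: "\<And>z. z \<in> cball 0 R \<Longrightarrow> norm (p z) \<le> M" and z: "z \<in> cball 0 r" "w \<in> cball 0 r"
  shows "norm (p z - p w) \<le> M / (R - r) * norm (z - w)"
proof (rule field_differentiable_bound[of "cball 0 r" p "deriv p"])
  fix x :: complex assume x: "x \<in> cball 0 r"
  then have "x \<in> unit_disk" using R by auto
  then show "(p has_field_derivative deriv p x) (at x within cball 0 r)"
    using holomorphic_derivI[OF p open_ball] has_field_derivative_at_within by blast
  show "norm (deriv p x) \<le> M / (R - r)"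
    using Cauchy_deriv_bound_disk[OF p R M x] by blast
qed (use z in auto)

text \<open>The bound on \<open>G z t\<close> comes with an exceptional null set that may depend on \<open>z\<close>. It is used only for
  \<open>z\<close> in a countable dense subset of the closed disk, where the null sets can be united, and extends
  to the whole disk by continuity of \<open>\<lambda>z. G z t\<close>.\<close>

lemma herglotz_vector_field_uniform_bound:
  assumes G: "herglotz_vector_field G" and R: "R < 1"
  obtains k N where "\<And>t. t \<ge> 0 \<Longrightarrow> k t \<ge> 0" "locally_integrable k" "negligible N"
    "\<And>t. t \<ge> 0 \<Longrightarrow> t \<notin> N \<Longrightarrow> (\<lambda>z. G z t) holomorphic_on unit_disk"
    "\<And>t z. t \<ge> 0 \<Longrightarrow> t \<notin> N \<Longrightarrow> z \<in> cball 0 R \<Longrightarrow> norm (G z t) \<le> k t"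
proof -
  have sub: "cball (0::complex) R \<subseteq> unit_disk" using R by auto
  obtain k where k: "\<And>t. t \<ge> 0 \<Longrightarrow> k t \<ge> 0" "locally_integrable k"
    "\<And>z. z \<in> cball 0 R \<Longrightarrow> AE t in lebesgue_on {0..}. norm (G z t) \<le> k t"
    using G sub compact_cball unfolding herglotz_vector_field_def by meson
  obtain D :: "complex set" where D: "countable D" "D \<subseteq> cball 0 R" "cball 0 R \<subseteq> closure D"
    using separable by blast
  have "AE t in lebesgue_on {0..}. \<forall>z\<in>D. norm (G z t) \<le> k t"
    by (rule AE_ball_countable') (use D k in auto)
  moreover have "AE t in lebesgue_on {0..}. infinitesimal_generator (\<lambda>z. G z t)"
    using G unfolding herglotz_vector_field_def by blast
  ultimately have "AE t in lebesgue_on {0..}. (\<forall>z\<in>D. norm (G z t) \<le> k t) \<and> infinitesimal_generator (\<lambda>z. G z t)"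
    by simp
  then obtain N where N: "negligible N"
    "\<And>t. t \<ge> 0 \<Longrightarrow> t \<notin> N \<Longrightarrow> (\<forall>z\<in>D. norm (G z t) \<le> k t) \<and> infinitesimal_generator (\<lambda>z. G z t)"
    by (rule AE_halfline_negligible) blast
  have hol: "(\<lambda>z. G z t) holomorphic_on unit_disk" if t: "t \<ge> 0" "t \<notin> N" for t
  proof -
    obtain \<tau> q where q: "q holomorphic_on unit_disk"
      and eq: "\<And>z. z \<in> unit_disk \<Longrightarrow> G z t = (\<tau> - z) * (1 - cnj \<tau> * z) * q z"
      using N(2)[OF t] unfolding infinitesimal_generator_def by blast
    have "(\<lambda>z. (\<tau> - z) * (1 - cnj \<tau> * z) * q z) holomorphic_on unit_disk"
      using q by (intro holomorphic_intros)
    then show ?thesis using eq holomorphic_transform by (metis (no_types, lifting))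
  qed
  have "norm (G z t) \<le> k t" if t: "t \<ge> 0" "t \<notin> N" and z: "z \<in> cball 0 R" for t z
  proof -
    have "continuous_on (cball 0 R) (\<lambda>z. G z t)"
      using hol[OF t] sub holomorphic_on_imp_continuous_on holomorphic_on_subset by blast
    then have "closed {z \<in> cball 0 R. norm (G z t) \<le> k t}"
      by (intro continuous_on_closed_Collect_le continuous_intros) auto
    moreover have "D \<subseteq> {z \<in> cball 0 R. norm (G z t) \<le> k t}"
      using D N(2)[OF t] by auto
    ultimately show ?thesis using closure_minimal D(3) z by blast
  qed
  with k N(1) hol show thesis by (intro that[of k N]) auto
qed

text \<open>Cauchy's estimate turns the boundedness and uniform continuity of \<open>(z, t) \<mapsto> g t z\<close> on a compact
  set into the same properties of the \<open>z\<close>-derivative on a smaller one: variation in \<open>t\<close> is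
  controlled by the estimate for \<open>g u - g v\<close>, variation in \<open>z\<close> by the second derivative.\<close>

lemma deriv_bounded_uniformly_continuous:
  assumes holo: "\<And>t. t \<ge> 0 \<Longrightarrow> g t holomorphic_on unit_disk"
    and cont: "continuous_on (unit_disk \<times> {0..}) (\<lambda>(z, t). g t z)"
    and s: "0 \<le> s" and r: "r < 1"
  shows "\<exists>M. \<forall>u\<in>{s..T}. \<forall>z\<in>cball 0 r. norm (deriv (g u) z) \<le> M"
    and "\<epsilon> > 0 \<Longrightarrow> \<exists>\<delta>>0. \<forall>u\<in>{s..T}. \<forall>v\<in>{s..T}. \<forall>z\<in>cball 0 r. \<forall>w\<in>cball 0 r.
           \<bar>u - v\<bar> < \<delta> \<longrightarrow> dist z w < \<delta> \<longrightarrow> norm (deriv (g u) z - deriv (g v) w) \<le> \<epsilon>"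
proof -
  obtain R1 where R1: "r < R1" "R1 < 1" using r dense by blast
  obtain R where R: "R1 < R" "R < 1" using R1 dense by blast
  have comp: "compact (cball (0::complex) R \<times> {s..T})" by (intro compact_Times compact_cball compact_Icc)
  have cont': "continuous_on (cball 0 R \<times> {s..T}) (\<lambda>(z, t). g t z)"
    by (rule continuous_on_subset[OF cont]) (use R s in auto)
  then have "compact ((\<lambda>(z, t). g t z) ` (cball 0 R \<times> {s..T}))"
    using comp compact_continuous_image by blast
  then obtain M where M: "\<And>u z. u \<in> {s..T} \<Longrightarrow> z \<in> cball 0 R \<Longrightarrow> norm (g u z) \<le> M"
    by (force dest!: compact_imp_bounded simp: bounded_iff)
  have hol: "g u holomorphic_on unit_disk" if "u \<in> {s..T}" for u
    using holo s that by simp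
  have d1: "norm (deriv (g u) z) \<le> M / (R - R1)" if "u \<in> {s..T}" "z \<in> cball 0 R1" for u z
    by (rule Cauchy_deriv_bound_disk[OF hol R M]) (use that in auto)
  show "\<exists>M. \<forall>u\<in>{s..T}. \<forall>z\<in>cball 0 r. norm (deriv (g u) z) \<le> M"
    using d1 R1 by (intro exI[of _ "M / (R - R1)"]) auto
  assume "\<epsilon> > 0"
  define L where "L = \<bar>M / (R - R1) / (R1 - r)\<bar>"
  have lip: "norm (deriv (g u) z - deriv (g u) w) \<le> L * norm (z - w)"
    if "u \<in> {s..T}" "z \<in> cball 0 r" "w \<in> cball 0 r" for u z w
  proof -
    have "norm (deriv (g u) z - deriv (g u) w) \<le> M / (R - R1) / (R1 - r) * norm (z - w)"
      by (rule Cauchy_Lipschitz_disk[OF holomorphic_deriv[OF hol] R1 d1]) (use that in auto)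
    also have "\<dots> \<le> L * norm (z - w)" unfolding L_def by (rule mult_right_mono[OF abs_ge_self norm_ge_zero])
    finally show ?thesis .
  qed
  define \<eta> where "\<eta> = \<epsilon> / 2 * (R - r)"
  have "\<eta> > 0" using \<open>\<epsilon> > 0\<close> R R1 by (auto simp: \<eta>_def)
  have "uniformly_continuous_on (cball 0 R \<times> {s..T}) (\<lambda>(z, t). g t z)"
    by (rule compact_uniformly_continuous[OF cont' comp])
  then obtain d where d: "d > 0" "\<And>x y. x \<in> cball 0 R \<times> {s..T} \<Longrightarrow> y \<in> cball 0 R \<times> {s..T} \<Longrightarrow> dist y x < d \<Longrightarrow>
      dist (case y of (z, t) \<Rightarrow> g t z) (case x of (z, t) \<Rightarrow> g t z) < \<eta>"
    using \<open>\<eta> > 0\<close> unfolding uniformly_continuous_on_def by metis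
  have g_diff: "norm (g u z - g v z) \<le> \<eta>" if "u \<in> {s..T}" "v \<in> {s..T}" "\<bar>u - v\<bar> < d" "z \<in> cball 0 R" for u v z
    using d(2)[of "(z, v)" "(z, u)"] that by (auto simp: dist_Pair_Pair dist_norm)
  have t_diff: "norm (deriv (g u) z - deriv (g v) z) \<le> \<epsilon> / 2"
    if uv: "u \<in> {s..T}" "v \<in> {s..T}" "\<bar>u - v\<bar> < d" and z: "z \<in> cball 0 r" for u v z
  proof -
    have "z \<in> unit_disk" using z r by auto
    then have "deriv (\<lambda>x. g u x - g v x) z = deriv (g u) z - deriv (g v) z"
      using hol uv by (intro deriv_diff) (use holomorphic_on_imp_differentiable_at[OF _ open_ball] in blast)+
    moreover have "norm (deriv (\<lambda>x. g u x - g v x) z) \<le> \<eta> / (R - r)"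
      by (rule Cauchy_deriv_bound_disk[OF _ _ R(2) _ z]) 
         (use R R1 hol uv g_diff in \<open>auto intro!: holomorphic_intros\<close>)
    moreover have "\<eta> / (R - r) = \<epsilon> / 2"
    proof -
      have "R - r \<noteq> 0" using R R1 by simp
      then show ?thesis unfolding \<eta>_def by (rule nonzero_mult_div_cancel_right)
    qed
    ultimately show ?thesis by simp
  qed
  define \<delta> where "\<delta> = min d (\<epsilon> / 2 / (L + 1))"
  have "L \<ge> 0" by (simp add: L_def)
  show "\<exists>\<delta>>0. \<forall>u\<in>{s..T}. \<forall>v\<in>{s..T}. \<forall>z\<in>cball 0 r. \<forall>w\<in>cball 0 r.
           \<bar>u - v\<bar> < \<delta> \<longrightarrow> dist z w < \<delta> \<longrightarrow> norm (deriv (g u) z - deriv (g v) w) \<le> \<epsilon>"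
  proof (intro exI[of _ \<delta>] conjI ballI impI)
    show "\<delta> > 0" using d \<open>\<epsilon> > 0\<close> \<open>L \<ge> 0\<close> by (auto simp: \<delta>_def)
  next
    fix u v and z w :: complex
    assume uv: "u \<in> {s..T}" "v \<in> {s..T}" and zw: "z \<in> cball 0 r" "w \<in> cball 0 r"
      and uv': "\<bar>u - v\<bar> < \<delta>" and zw': "dist z w < \<delta>"
    have "norm (deriv (g v) z - deriv (g v) w) \<le> L * norm (z - w)"
      by (rule lip[OF uv(2) zw])
    also have "\<dots> \<le> (L + 1) * (\<epsilon> / 2 / (L + 1))"
      using zw' \<open>L \<ge> 0\<close> by (intro mult_mono) (auto simp: \<delta>_def dist_norm)
    also have "\<dots> = \<epsilon> / 2"
    proof -
      have "L + 1 \<noteq> 0" using \<open>L \<ge> 0\<close> by simp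
      then show ?thesis by (metis nonzero_mult_div_cancel_left times_divide_eq_right)
    qed
    finally have 1: "norm (deriv (g v) z - deriv (g v) w) \<le> \<epsilon> / 2" .
    have 2: "norm (deriv (g u) z - deriv (g v) z) \<le> \<epsilon> / 2"
      by (rule t_diff[OF uv _ zw(1)]) (use uv' in \<open>simp add: \<delta>_def\<close>)
    show "norm (deriv (g u) z - deriv (g v) w) \<le> \<epsilon>"
      using norm_triangle_ineq[of "deriv (g u) z - deriv (g v) z" "deriv (g v) z - deriv (g v) w"] 1 2 by simp
  qed
qed

section \<open>The transport equation along trajectories\<close>

text \<open>Write \<open>c = deriv (g x) (w x)\<close> for a short interval \<open>{x..y}\<close>. The increment of \<open>t \<mapsto> g t (w t)\<close> is
  the sum of the increment of \<open>u \<mapsto> c * w u + g u (w y)\<close> and of the linearisation error of \<open>g x\<close>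
  between \<open>w x\<close> and \<open>w y\<close>. In the first term the spatial argument of \<open>g\<close> is fixed, so the equation
  holds outside one null set, and the almost everywhere derivative
  \<open>c * G (w u) u - deriv (g u) (w y) * G (w y) u\<close> is small compared with the majorant \<open>k u\<close> of \<open>G\<close>,
  because \<open>deriv (g u) (w y)\<close> is close to \<open>c\<close> and \<open>G\<close> is Lipschitz in \<open>z\<close> with a constant
  proportional to \<open>k u\<close>. The second term is small compared with \<open>norm (w y - w x)\<close>, which is at most
  the integral of \<open>k\<close>.\<close>

lemma first_integral_of_transport_equation:
  fixes g :: "real \<Rightarrow> complex \<Rightarrow> complex" and G :: "complex \<Rightarrow> real \<Rightarrow> complex"
  assumes holo: "\<And>t. t \<ge> 0 \<Longrightarrow> g t holomorphic_on unit_disk"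
    and cont: "continuous_on (unit_disk \<times> {0..}) (\<lambda>(z, t). g t z)"
    and ac: "\<And>z. z \<in> unit_disk \<Longrightarrow> locally_abs_cont_from 0 (\<lambda>t. g t z)"
    and herglotz: "herglotz_vector_field G"
    and pde: "\<And>z. z \<in> unit_disk \<Longrightarrow>
       AE t in lebesgue_on {0..}.
         ((\<lambda>t. g t z) has_vector_derivative - deriv (g t) z * G z t) (at t within {0..})"
    and s: "0 \<le> s" "s \<le> T"
    and w_disk: "\<And>u. u \<in> {s..T} \<Longrightarrow> w u \<in> unit_disk"
    and w_ac: "abs_cont_on {s..T} w"
    and w_ode: "AE u in lebesgue_on {s..}. (w has_vector_derivative G (w u) u) (at u within {s..})"
  shows "g T (w T) = g s (w s)"
proof -
  have w_cont: "continuous_on {s..T} w" by (rule abs_cont_on_imp_continuous_on[OF w_ac])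
  obtain r where r: "r < 1" and wr: "\<And>u. u \<in> {s..T} \<Longrightarrow> w u \<in> cball 0 r"
  proof -
    obtain u0 where "u0 \<in> {s..T}" "\<And>u. u \<in> {s..T} \<Longrightarrow> norm (w u) \<le> norm (w u0)"
      using continuous_attains_sup[of "{s..T}" "\<lambda>u. norm (w u)"] continuous_on_norm[OF w_cont] s
      by auto
    then show thesis using w_disk[of u0] by (intro that[of "norm (w u0)"]) auto
  qed
  obtain R where R: "r < R" "R < 1" using r dense by blast
  obtain k N where k0: "\<And>t. t \<ge> 0 \<Longrightarrow> k t \<ge> 0" and kloc: "locally_integrable k" and N: "negligible N"
    and Ghol: "\<And>t. t \<ge> 0 \<Longrightarrow> t \<notin> N \<Longrightarrow> (\<lambda>z. G z t) holomorphic_on unit_disk"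
    and Gk: "\<And>t z. t \<ge> 0 \<Longrightarrow> t \<notin> N \<Longrightarrow> z \<in> cball 0 R \<Longrightarrow> norm (G z t) \<le> k t"
    using herglotz_vector_field_uniform_bound[OF herglotz R(2)] by metis
  have Glip: "norm (G z t - G z' t) \<le> k t / (R - r) * norm (z - z')"
    if "t \<ge> 0" "t \<notin> N" "z \<in> cball 0 r" "z' \<in> cball 0 r" for t z z'
    by (rule Cauchy_Lipschitz_disk[OF Ghol R Gk]) (use that in auto)
  have kint: "k integrable_on {x..y}" if "0 \<le> x" for x y
  proof (cases "x \<le> y")
    case True
    have "set_integrable lebesgue {0..y} k" 
      using kloc True that unfolding locally_integrable_def by auto
    then have "k integrable_on {0..y}" by (rule set_lebesgue_integral_eq_integral(1))
    then show ?thesis by (rule integrable_subinterval_real) (use that in auto)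
  qed auto
  obtain N2 where N2: "negligible N2"
    "\<And>u. u \<ge> s \<Longrightarrow> u \<notin> N2 \<Longrightarrow> (w has_vector_derivative G (w u) u) (at u within {s..})"
    using AE_halfline_negligible[OF w_ode] by metis
  obtain M where M: "\<And>u z. u \<in> {s..T} \<Longrightarrow> z \<in> cball 0 r \<Longrightarrow> norm (deriv (g u) z) \<le> M"
    using deriv_bounded_uniformly_continuous(1)[OF holo cont s(1) r, of T] by blast
  have "M \<ge> 0" using M[of s "w s"] wr[of s] s norm_ge_zero order_trans by (metis atLeastAtMost_iff order_refl)
  have kI: "k integrable_on {s..T}" using kint s(1) .
  show ?thesis
  proof (rule constant_if_locally_small_increments[OF s(2) kI])
    fix \<epsilon> :: real assume "\<epsilon> > 0"
    \<comment> \<open>\<open>C\<close> collects the three errors found below: \<open>\<eta>\<close> for the variation of the derivative,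
      \<open>M / (R - r) * \<eta>\<close> for the variation of \<open>G\<close>, and \<open>\<eta>\<close> for the linearisation\<close>
    define C where "C = 2 + M / (R - r)"
    have "C > 0" using \<open>M \<ge> 0\<close> R by (auto simp: C_def intro!: add_pos_nonneg)
    define \<eta> where "\<eta> = \<epsilon> / C"
    have "\<eta> > 0" using \<open>\<epsilon> > 0\<close> \<open>C > 0\<close> by (simp add: \<eta>_def)
    obtain d1 where d1: "d1 > 0" "\<And>u v z z'. \<lbrakk>u \<in> {s..T}; v \<in> {s..T}; z \<in> cball 0 r; z' \<in> cball 0 r;
        \<bar>u - v\<bar> < d1; dist z z' < d1\<rbrakk> \<Longrightarrow> norm (deriv (g u) z - deriv (g v) z') \<le> \<eta>"
      using deriv_bounded_uniformly_continuous(2)[OF holo cont s(1) r \<open>\<eta> > 0\<close>, of T] by meson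
    have "uniformly_continuous_on {s..T} w"
      by (rule compact_uniformly_continuous[OF w_cont]) auto
    moreover have "min d1 \<eta> > 0" using d1 \<open>\<eta> > 0\<close> by simp
    ultimately obtain d2 where d2: "d2 > 0"
      "\<And>u v. u \<in> {s..T} \<Longrightarrow> v \<in> {s..T} \<Longrightarrow> dist u v < d2 \<Longrightarrow> dist (w u) (w v) < min d1 \<eta>"
      unfolding uniformly_continuous_on_def by metis
    have "norm (g y (w y) - g x (w x)) \<le> \<epsilon> * integral {x..y} k"
      if xy: "s \<le> x" "x \<le> y" "y \<le> T" "y - x < min d1 d2" for x y
    proof -
      define c where "c = deriv (g x) (w x)"
      define K where "K = integral {x..y} k"
      have kxy: "k integrable_on {x..y}" using kint s xy by auto
      have in_I: "u \<in> {s..T}" "u \<ge> 0" if "u \<in> {x..y}" for u using that xy s by auto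
      have x: "x \<in> {s..T}" and y: "y \<in> {s..T}" using xy by auto
      have wclose: "dist (w u) (w v) < d1" "dist (w u) (w v) < \<eta>" if "u \<in> {x..y}" "v \<in> {x..y}" for u v
        using d2(2)[of u v] that xy by (auto simp: dist_real_def)
      have y_disk: "w y \<in> unit_disk" by (rule w_disk[OF y])
      obtain N3 where N3: "negligible N3"
        "\<And>u. u \<ge> 0 \<Longrightarrow> u \<notin> N3 \<Longrightarrow> ((\<lambda>t. g t (w y)) has_vector_derivative - deriv (g u) (w y) * G (w y) u) (at u within {0..})"
        using AE_halfline_negligible[OF pde[OF y_disk]] by metis
      have w_int: "((\<lambda>u. G (w u) u) has_integral (w y - w x)) {x..y}"
      proof (rule fundamental_theorem_of_calculus_abs_cont[OF xy(2) _ N2(1)])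
        show "abs_cont_on {x..y} w" by (rule abs_cont_on_subset[OF w_ac]) (use xy in auto)
        show "(w has_vector_derivative G (w u) u) (at u within {x..y})" if "u \<in> {x..y} - N2" for u
          by (rule has_vector_derivative_within_subset[OF N2(2)]) (use that xy in auto)
      qed
      have g_int: "((\<lambda>u. - deriv (g u) (w y) * G (w y) u) has_integral (g y (w y) - g x (w y))) {x..y}"
      proof (rule fundamental_theorem_of_calculus_abs_cont[OF xy(2) _ N3(1)])
        have "abs_cont_on {0..y} (\<lambda>t. g t (w y))"
          using ac[OF y_disk] s xy unfolding locally_abs_cont_from_def by auto
        then show "abs_cont_on {x..y} (\<lambda>t. g t (w y))" 
          by (rule abs_cont_on_subset) (use xy s in auto)
        show "((\<lambda>t. g t (w y)) has_vector_derivative - deriv (g u) (w y) * G (w y) u) (at u within {x..y})" 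
          if "u \<in> {x..y} - N3" for u
          by (rule has_vector_derivative_within_subset[OF N3(2)]) (use that xy s in auto)
      qed
      have w_incr: "norm (w y - w x) \<le> K"
        unfolding K_def
        by (rule has_integral_norm_bound_integral_ae[OF w_int kxy N])
          (use Gk in_I wr R in force)
      have "((\<lambda>u. c * G (w u) u + - deriv (g u) (w y) * G (w y) u) has_integral
              (c * (w y - w x) + (g y (w y) - g x (w y)))) {x..y}"
        by (intro has_integral_add has_integral_mult_right w_int g_int)
      then have "norm (c * (w y - w x) + (g y (w y) - g x (w y))) \<le> integral {x..y} (\<lambda>u. (\<eta> + M / (R - r) * \<eta>) * k u)"
      proof (rule has_integral_norm_bound_integral_ae[OF _ _ N])
        show "(\<lambda>u. (\<eta> + M / (R - r) * \<eta>) * k u) integrable_on {x..y}"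
          using kxy integrable_on_mult_right by blast
        fix u assume u: "u \<in> {x..y} - N"
        have ku: "k u \<ge> 0" using k0 in_I u by auto
        have wu: "w u \<in> cball 0 r" "w y \<in> cball 0 r" "w x \<in> cball 0 r" using wr in_I u x y by auto
        have "norm (c * G (w u) u + - deriv (g u) (w y) * G (w y) u)
           = norm ((c - deriv (g u) (w y)) * G (w y) u + c * (G (w u) u - G (w y) u))"
          by (simp add: algebra_simps)
        also have "\<dots> \<le> norm (c - deriv (g u) (w y)) * norm (G (w y) u) + norm c * norm (G (w u) u - G (w y) u)"
          by (metis norm_mult norm_triangle_ineq)
        also have "\<dots> \<le> \<eta> * k u + M * (k u / (R - r) * \<eta>)"
        proof (intro add_mono mult_mono)
          show "norm (c - deriv (g u) (w y)) \<le> \<eta>"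
            unfolding c_def by (rule d1(2)) (use u xy wu in_I x wclose in auto)
          show "norm (G (w y) u) \<le> k u" using Gk u wu in_I R by force
          show "norm c \<le> M" unfolding c_def by (rule M) (use x wu in auto)
          have "norm (G (w u) u - G (w y) u) \<le> k u / (R - r) * norm (w u - w y)"
            by (rule Glip) (use u wu in_I in auto)
          also have "\<dots> \<le> k u / (R - r) * \<eta>"
            using wclose(2)[of u y] u xy ku R by (intro mult_left_mono) (auto simp: dist_norm)
          finally show "norm (G (w u) u - G (w y) u) \<le> k u / (R - r) * \<eta>" .
        qed (use ku \<open>\<eta> > 0\<close> \<open>M \<ge> 0\<close> in auto)
        also have "\<dots> = (\<eta> + M / (R - r) * \<eta>) * k u" by (simp add: algebra_simps)
        finally show "norm (c * G (w u) u + - deriv (g u) (w y) * G (w y) u) \<le> (\<eta> + M / (R - r) * \<eta>) * k u" .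
      qed
      then have A: "norm (c * (w y - w x) + (g y (w y) - g x (w y))) \<le> (\<eta> + M / (R - r) * \<eta>) * K"
        by (simp add: K_def)
      have "norm ((g x (w y) - c * w y) - (g x (w x) - c * w x)) \<le> \<eta> * norm (w y - w x)"
      proof (rule field_differentiable_bound[of "cball 0 r \<inter> ball (w x) d1" _ "\<lambda>z. deriv (g x) z - c"])
        show "convex (cball 0 r \<inter> ball (w x) d1)" by (intro convex_Int) auto
        fix z assume z: "z \<in> cball 0 r \<inter> ball (w x) d1"
        show "((\<lambda>z. g x z - c * z) has_field_derivative deriv (g x) z - c) (at z within cball 0 r \<inter> ball (w x) d1)"
        proof (rule has_field_derivative_at_within)
          have "(g x has_field_derivative deriv (g x) z) (at z)"
            by (rule holomorphic_derivI[OF holo open_ball]) (use z r x s in auto)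
          then show "((\<lambda>z. g x z - c * z) has_field_derivative deriv (g x) z - c) (at z)"
            by (auto intro!: derivative_eq_intros)
        qed
        show "norm (deriv (g x) z - c) \<le> \<eta>" unfolding c_def
          by (rule d1(2)) (use x z wr d1 in \<open>auto simp: dist_commute\<close>)
      qed (use wr[OF x] wr[OF y] wclose(1)[of x y] xy d1 in auto)
      then have B: "norm ((g x (w y) - c * w y) - (g x (w x) - c * w x)) \<le> \<eta> * K"
        using w_incr \<open>\<eta> > 0\<close> by (meson mult_left_mono less_imp_le order_trans)
      have "g y (w y) - g x (w x) = (c * (w y - w x) + (g y (w y) - g x (w y))) + ((g x (w y) - c * w y) - (g x (w x) - c * w x))"
        by (simp add: algebra_simps)
      then have "norm (g y (w y) - g x (w x)) \<le> (\<eta> + M / (R - r) * \<eta>) * K + \<eta> * K"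
        using A B norm_triangle_mono by metis
      also have "\<dots> = \<epsilon> * K"
      proof -
        have "\<epsilon> = \<eta> * C" using \<open>C > 0\<close> by (simp add: \<eta>_def)
        then show ?thesis by (simp add: C_def algebra_simps)
      qed
      finally show ?thesis by (simp add: K_def)
    qed
    moreover have "min d1 d2 > 0" using d1 d2 by simp
    ultimately show "\<exists>\<delta>>0. \<forall>x y. s \<le> x \<and> x \<le> y \<and> y \<le> T \<and> y - x < \<delta> \<longrightarrow>
        norm (g y (w y) - g x (w x)) \<le> \<epsilon> * integral {x..y} k" by blast
  qed
qed

section \<open>Injective entire functions\<close>

text \<open>The quotient \<open>P z = (F z - F 0) / z\<close> extends to an entire function without zeros. By the open
  mapping theorem and injectivity, \<open>F\<close> maps the complement of the unit disk outside a disk about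
  \<open>F 0\<close>, so \<open>1 / P\<close> grows at most linearly and is a polynomial of degree at most one. Having no
  zeros, it is constant.\<close>

lemma injective_entire_imp_affine:
  assumes holF: "F holomorphic_on UNIV" and inj: "inj F"
  obtains a b where "b \<noteq> 0" "\<And>z. F z = a + b * z"
proof -
  define P where "P = (\<lambda>z. if z = 0 then deriv F 0 else (F z - F 0) / (z - 0))"
  have holP: "P holomorphic_on UNIV"
    unfolding P_def by (rule pole_lemma_open[OF holF]) auto
  have dF: "deriv F 0 \<noteq> 0"
    using holomorphic_injective_imp_regular[OF holF, of 0] inj by auto
  have nz: "P z \<noteq> 0" for z
    using dF inj by (auto simp: P_def inj_def)
  have holQ: "(\<lambda>z. inverse (P z)) holomorphic_on UNIV"
    using holP nz by (intro holomorphic_intros) auto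
  have "open (F ` ball 0 1)"
    by (rule open_mapping_thm3) (use holF inj in \<open>auto intro: holomorphic_on_subset inj_on_subset\<close>)
  then obtain r where r: "r > 0" "ball (F 0) r \<subseteq> F ` ball 0 1"
    by (meson centre_in_ball image_eqI openE zero_less_one)
  have far: "norm (F z - F 0) \<ge> r" if "norm z \<ge> 1" for z
  proof (rule ccontr)
    assume "\<not> ?thesis"
    then have "F z \<in> F ` ball 0 1" using r by (auto simp: dist_norm norm_minus_commute)
    then have "z \<in> ball 0 1" using inj_image_mem_iff[OF inj] by blast
    with that show False by simp
  qed
  have lin: "norm (inverse (P z)) \<le> inverse r * norm z ^ 1" if "1 \<le> norm z" for z
  proof -
    have "z \<noteq> 0" using that by auto
    then have "norm (inverse (P z)) = norm z / norm (F z - F 0)"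
      by (simp add: P_def norm_divide norm_inverse)
    also have "\<dots> \<le> norm z / r"
      using far[OF that] r(1) by (intro divide_left_mono mult_pos_pos) auto
    finally show ?thesis by (simp add: field_simps)
  qed
  have Q: "inverse (P z) = inverse (P 0) + deriv (\<lambda>z. inverse (P z)) 0 * z" for z
    using Liouville_polynomial[OF holQ lin, where \<xi> = z] by simp
  define c where "c = deriv (\<lambda>z. inverse (P z)) 0"
  have "c = 0"
  proof (rule ccontr)
    assume "c \<noteq> 0"
    then have "inverse (P (- inverse (P 0) / c)) = 0" 
      by (subst Q) (simp add: c_def)
    then show False using nz by simp
  qed
  then have P: "P z = P 0" for z
    using Q[of z] by (simp add: c_def)
  have "F z = F 0 + P 0 * z" for z
    using P[of z] by (cases "z = 0") (auto simp: P_def field_simps)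
  then show ?thesis using that nz by blast
qed

section \<open>Hyperbolic distance in exhausting domains\<close>

text \<open>The Schwarz lemma for \<open>h\<close>, after the ball is rescaled to the unit disk and \<open>h a\<close> is moved to \<open>0\<close>
  by a disk automorphism.\<close>

lemma Schwarz_Pick_ball:
  assumes hol: "h holomorphic_on ball a R" and maps: "h ` ball a R \<subseteq> unit_disk" and "R > 0" and b: "b \<in> ball a R"
  shows "norm (Moebius_function 0 (h a) (h b)) \<le> dist a b / R"
proof -
  define A where "A = (\<lambda>\<zeta>::complex. a + of_real R * \<zeta>)"
  have A: "A ` unit_disk \<subseteq> ball a R"
    using \<open>R > 0\<close> by (auto simp: A_def dist_norm norm_mult)
  have "a \<in> ball a R" using \<open>R > 0\<close> by simp
  then have ha: "h a \<in> unit_disk" using maps by blast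
  define P where "P = Moebius_function 0 (h a) \<circ> (h \<circ> A)"
  have "A holomorphic_on unit_disk" unfolding A_def by (intro holomorphic_intros)
  then have "(h \<circ> A) holomorphic_on unit_disk"
    using hol A by (rule holomorphic_on_compose_gen)
  moreover have "Moebius_function 0 (h a) holomorphic_on unit_disk"
    using ha by (intro Moebius_function_holomorphic) simp
  moreover have "(h \<circ> A) ` unit_disk \<subseteq> unit_disk"
    using A maps by (auto simp only: image_comp[symmetric])
  ultimately have holP: "P holomorphic_on unit_disk"
    unfolding P_def by (rule holomorphic_on_compose_gen)
  define \<xi> where "\<xi> = (b - a) / of_real R"
  have \<xi>: "norm \<xi> = dist a b / R" "A \<xi> = b"
    using \<open>R > 0\<close> by (simp_all add: \<xi>_def A_def norm_divide dist_norm norm_minus_commute)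
  have "norm (P \<xi>) \<le> norm \<xi>"
  proof (rule Schwarz_Lemma(1)[OF holP])
    show "P 0 = 0" by (simp add: P_def A_def Moebius_function_eq_zero)
    show "norm (P z) < 1" if "norm z < 1" for z
    proof -
      have "h (A z) \<in> unit_disk" using A maps that by (auto simp: image_subset_iff)
      then show ?thesis using ha by (auto simp: P_def intro!: Moebius_function_norm_lt_1)
    qed
    show "norm \<xi> < 1" using \<xi> b \<open>R > 0\<close> by simp
  qed
  then show ?thesis using \<xi> by (simp add: P_def)
qed

text \<open>A ball about \<open>a\<close> of a radius \<open>R\<close> much larger than \<open>dist a b\<close> is compact, hence contained in
  \<open>f t ` unit_disk\<close> for a large \<open>t\<close>. On it the inverse of \<open>f t\<close> maps into the unit disk, and the
  Schwarz-Pick inequality makes the hyperbolic distance of the two preimages small.\<close>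

lemma hyp_disk_contains_preimages:
  assumes inj: "\<And>t. t \<ge> 0 \<Longrightarrow> univalent_on (f t) unit_disk"
    and mono: "\<And>s t. 0 \<le> s \<Longrightarrow> s \<le> t \<Longrightarrow> f s ` unit_disk \<subseteq> f t ` unit_disk"
    and range: "loewner_range f = UNIV" and "\<rho> > 0"
  obtains t z \<zeta> where "t \<ge> 0" "z \<in> unit_disk" "\<zeta> \<in> hyp_disk z \<rho>" "z \<in> hyp_disk z \<rho>" "f t z = b" "f t \<zeta> = a"
proof -
  have "isCont artanh (0::real)" by (intro isCont_artanh) auto
  then obtain d where d: "d > 0" "\<And>x::real. \<bar>x\<bar> < d \<Longrightarrow> \<bar>artanh x\<bar> < \<rho> / 2"
    using \<open>\<rho> > 0\<close> unfolding continuous_at_eps_delta by (metis artanh_0 diff_zero half_gt_zero real_norm_def dist_real_def)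
  \<comment> \<open>large enough for \<open>b\<close> to lie in the ball and for \<open>dist a b / R < d\<close>\<close>
  define R where "R = dist a b / d + dist a b + 1"
  have R: "R > 0" "dist a b < R" "dist a b / R < d"
    using d(1) by (auto simp: R_def field_simps add_pos_nonneg add_nonneg_pos intro!: add_pos_nonneg add_nonneg_pos)
  have op: "open (f t ` unit_disk)" if "t \<ge> 0" for t
    using inj[OF that] open_mapping_thm3 unfolding univalent_on_def by auto
  have "cball a R \<subseteq> (\<Union>t\<in>{0..}. f t ` unit_disk)"
    using range unfolding loewner_range_def by auto
  then obtain C where C: "C \<subseteq> {0..}" "finite C" "cball a R \<subseteq> (\<Union>t\<in>C. f t ` unit_disk)"
    using compactE_image[OF compact_cball, of "{0..}" "\<lambda>t. f t ` unit_disk" a R] op by auto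
  define t where "t = Max (insert 0 C)"
  have t: "t \<ge> 0" "\<And>s. s \<in> C \<Longrightarrow> s \<le> t" using C(2) by (auto simp: t_def)
  have sub: "cball a R \<subseteq> f t ` unit_disk"
  proof
    fix x assume "x \<in> cball a R"
    then obtain s where "s \<in> C" "x \<in> f s ` unit_disk" using C(3) by blast
    then show "x \<in> f t ` unit_disk" using mono[of s t] t C(1) by auto
  qed
  obtain h where h: "h holomorphic_on (f t ` unit_disk)" "\<And>z. z \<in> unit_disk \<Longrightarrow> h (f t z) = z"
    using holomorphic_has_inverse[OF _ open_ball] inj[OF t(1)] unfolding univalent_on_def by metis
  have h': "h x \<in> unit_disk" "f t (h x) = x" if "x \<in> cball a R" for x
    using sub that h(2) by auto
  have ab: "a \<in> cball a R" "b \<in> cball a R" using R by auto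
  have "norm (Moebius_function 0 (h a) (h b)) \<le> dist a b / R"
  proof (rule Schwarz_Pick_ball)
    show "h holomorphic_on ball a R"
      by (rule holomorphic_on_subset[OF h(1)]) (use sub ball_subset_cball in blast)
    show "h ` ball a R \<subseteq> unit_disk" using h'(1) ball_subset_cball by blast
  qed (use R in auto)
  then have "hyp_dist (h b) (h a) < \<rho>"
    using d(2)[of "norm (Moebius_function 0 (h a) (h b))"] R(3) by (simp add: hyp_dist_def)
  moreover have "hyp_dist (h b) (h b) < \<rho>"
    using \<open>\<rho> > 0\<close> by (simp add: hyp_dist_def Moebius_function_eq_zero)
  ultimately show thesis
    using h' ab t(1) by (intro that[of t "h b" "h a"]) (auto simp: hyp_disk_def)
qed

section \<open>Uniformly locally univalent solutions\<close>

theorem theorem4p2: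
  fixes g :: "real \<Rightarrow> complex \<Rightarrow> complex" and G :: "complex \<Rightarrow> real \<Rightarrow> complex"
  assumes holo: "\<And>t. t \<ge> 0 \<Longrightarrow> g t holomorphic_on unit_disk"
    and cont: "continuous_on (unit_disk \<times> {0..}) (\<lambda>(z, t). g t z)"
    and ac: "\<And>z. z \<in> unit_disk \<Longrightarrow> locally_abs_cont_from 0 (\<lambda>t. g t z)"
    and herglotz: "herglotz_vector_field G"
    and pde: "\<And>z. z \<in> unit_disk \<Longrightarrow>
       AE t in lebesgue_on {0..}.
         ((\<lambda>t. g t z) has_vector_derivative - deriv (g t) z * G z t) (at t within {0..})"
    and range: "\<exists>f. loewner_chain_of G f \<and> loewner_range f = UNIV"
    and ulu: "uniformly_locally_univalent (g ` {0..})"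
  shows "loewner_chain_of G g"
proof -
  obtain f \<phi> where chain: "loewner_chain f" and f_range: "loewner_range f = UNIV"
    and \<phi>: "evolution_family_of G \<phi>"
    and f_\<phi>: "\<And>s t z. 0 \<le> s \<Longrightarrow> s \<le> t \<Longrightarrow> z \<in> unit_disk \<Longrightarrow> inv_into unit_disk (f t) (f s z) = \<phi> s t z"
    using range unfolding loewner_chain_of_def by blast
  have f_univ: "univalent_on (f t) unit_disk" if "t \<ge> 0" for t
    using chain[unfolded loewner_chain_def, THEN conjunct1] that by simp
  have f_mono: "f s ` unit_disk \<subseteq> f t ` unit_disk" if "0 \<le> s" "s \<le> t" for s t
    using chain[unfolded loewner_chain_def, THEN conjunct2, THEN conjunct1] that
    by (cases "s = t") simp_all
  have \<phi>_disk: "\<phi> s t z \<in> unit_disk" if "0 \<le> s" "s \<le> t" "z \<in> unit_disk" for s t z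
    using \<phi>[unfolded evolution_family_of_def, THEN conjunct1] that by blast
  have f_comp: "f t (\<phi> s t z) = f s z" if "0 \<le> s" "s \<le> t" "z \<in> unit_disk" for s t z
    using f_inv_into_f[of "f s z" "f t" unit_disk] subsetD[OF f_mono[OF that(1,2)] imageI[OF that(3)]]
      f_\<phi>[OF that] by simp
  have g_comp: "g t (\<phi> s t z) = g s z" if st: "0 \<le> s" "s \<le> t" and z: "z \<in> unit_disk" for s t z
  proof -
    have ev: "\<phi> s s z = z" "locally_abs_cont_from s (\<lambda>t. \<phi> s t z)"
      "AE u in lebesgue_on {s..}. ((\<lambda>t. \<phi> s t z) has_vector_derivative G (\<phi> s u z) u) (at u within {s..})"
      using \<phi>[unfolded evolution_family_of_def, THEN conjunct2] st(1) z by simp_all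
    have w_ac: "abs_cont_on {s..t} (\<lambda>t. \<phi> s t z)"
      using ev(2) st unfolding locally_abs_cont_from_def by blast
    have "g t (\<phi> s t z) = g s (\<phi> s s z)"
      by (rule first_integral_of_transport_equation[OF holo cont ac herglotz pde st, where w = "\<lambda>t. \<phi> s t z"])
        (use \<phi>_disk st z w_ac ev(3) in auto)
    then show ?thesis using ev(1) by simp
  qed
  have compat: "g s z = g t \<zeta>" if "0 \<le> s" "s \<le> t" "z \<in> unit_disk" "\<zeta> \<in> unit_disk" "f s z = f t \<zeta>" for s t z \<zeta>
  proof -
    have "f t (\<phi> s t z) = f t \<zeta>" using f_comp that by simp
    then have "\<phi> s t z = \<zeta>"
      using f_univ[of t] \<phi>_disk that unfolding univalent_on_def inj_on_def by force
    then show ?thesis using g_comp[OF that(1-3)] by simp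
  qed
  have "\<exists>t z. t \<ge> 0 \<and> z \<in> unit_disk \<and> f t z = x" for x
  proof -
    have "x \<in> loewner_range f" using f_range by simp
    then obtain t z where "t \<in> {0..}" "z \<in> unit_disk" "x = f t z"
      unfolding loewner_range_def by (elim UN_E imageE)
    then show ?thesis by (intro exI[of _ t] exI[of _ z]) simp
  qed
  then obtain \<theta> \<psi> where \<theta>\<psi>: "\<And>x. \<theta> x \<ge> 0" "\<And>x. \<psi> x \<in> unit_disk" "\<And>x. f (\<theta> x) (\<psi> x) = x" 
    by metis
  \<comment> \<open>\<open>compat\<close> makes the value independent of the choice of \<open>\<theta> x\<close> and \<open>\<psi> x\<close>\<close>
  define F where "F = (\<lambda>x. g (\<theta> x) (\<psi> x))"
  have F: "F (f t z) = g t z" if "t \<ge> 0" "z \<in> unit_disk" for t z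
    using compat[of t "\<theta> (f t z)" z "\<psi> (f t z)"] compat[of "\<theta> (f t z)" t "\<psi> (f t z)" z] \<theta>\<psi>[of "f t z"] that
    unfolding F_def by (cases "t \<le> \<theta> (f t z)") simp_all
  have F_holo: "F holomorphic_on f t ` unit_disk" if t: "t \<ge> 0" for t
  proof -
    obtain h where h: "h holomorphic_on (f t ` unit_disk)" "\<And>z. z \<in> unit_disk \<Longrightarrow> h (f t z) = z"
      using holomorphic_has_inverse[OF _ open_ball] f_univ[OF t] unfolding univalent_on_def by metis
    have "(g t \<circ> h) holomorphic_on f t ` unit_disk"
      by (rule holomorphic_on_compose_gen[OF h(1) holo[OF t]]) (use h(2) in auto)
    then show ?thesis
      by (rule holomorphic_transform) (use h(2) F t in auto)
  qed
  have "F holomorphic_on (\<Union>t\<in>{0..}. f t ` unit_disk)"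
    by (rule holomorphic_on_UN_open) 
      (use F_holo f_univ in \<open>auto intro!: open_mapping_thm3 simp: univalent_on_def\<close>)
  then have F_entire: "F holomorphic_on UNIV"
    using f_range unfolding loewner_range_def by simp
  obtain \<rho> where \<rho>: "\<rho> > 0" "\<And>t z. t \<ge> 0 \<Longrightarrow> z \<in> unit_disk \<Longrightarrow> univalent_on (g t) (hyp_disk z \<rho>)"
    using ulu unfolding uniformly_locally_univalent_def by auto
  have "inj F"
  proof (rule injI)
    fix a b assume eq: "F a = F b"
    obtain t z \<zeta> where *: "t \<ge> 0" "z \<in> unit_disk" "\<zeta> \<in> hyp_disk z \<rho>" "z \<in> hyp_disk z \<rho>" "f t z = b" "f t \<zeta> = a"
      using hyp_disk_contains_preimages[of f \<rho> b a] f_univ f_mono f_range \<rho>(1) by metis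
    then have "g t \<zeta> = g t z" using eq F[of t z] F[of t \<zeta>] by (auto simp: hyp_disk_def)
    then have "\<zeta> = z"
      using \<rho>(2)[OF *(1,2)] *(3,4) inj_onD unfolding univalent_on_def by metis
    then show "a = b" using * by simp
  qed
  then obtain \<alpha> \<beta> where \<beta>: "\<beta> \<noteq> 0" and affine: "\<And>x. F x = \<alpha> + \<beta> * x"
    using injective_entire_imp_affine[OF F_entire] by metis
  have g_affine: "g t z = \<alpha> + \<beta> * f t z" if "t \<ge> 0" "z \<in> unit_disk" for t z
    using F[OF that] affine by simp
  have g_inj: "inj_on (g t) unit_disk" if "t \<ge> 0" for t
    using f_univ[OF that] g_affine[OF that] \<beta> unfolding univalent_on_def inj_on_def by simp
  have "loewner_chain g"
    unfolding loewner_chain_def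
  proof (intro conjI allI impI)
    show "univalent_on (g t) unit_disk" if "t \<ge> 0" for t
      unfolding univalent_on_def using holo[OF that] g_inj[OF that] by (rule conjI)
    show "g s ` unit_disk \<subseteq> g t ` unit_disk" if "0 \<le> s \<and> s < t" for s t
    proof (rule image_subsetI)
      fix z :: complex assume "z \<in> unit_disk"
      then have "g s z = g t (\<phi> s t z)" "\<phi> s t z \<in> unit_disk"
        using g_comp[of s t z] \<phi>_disk[of s t z] that by simp_all
      then show "g s z \<in> g t ` unit_disk" by (rule image_eqI)
    qed
    fix K assume K: "compact K \<and> K \<subseteq> unit_disk"
    obtain k where k: "\<forall>t\<ge>0. k t \<ge> 0" "locally_integrable k"
      "\<forall>z\<in>K. \<forall>s t. 0 \<le> s \<and> s \<le> t \<longrightarrow> norm (f s z - f t z) \<le> (LINT \<xi>:{s..t}|lebesgue. k \<xi>)"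
      using chain[unfolded loewner_chain_def, THEN conjunct2, THEN conjunct2, THEN spec, THEN mp, OF K]
      by (elim exE conjE)
    show "\<exists>k. (\<forall>t\<ge>0. k t \<ge> 0) \<and> locally_integrable k \<and>
             (\<forall>z\<in>K. \<forall>s t. 0 \<le> s \<and> s \<le> t \<longrightarrow>
                norm (g s z - g t z) \<le> (LINT \<xi>:{s..t}|lebesgue. k \<xi>))"
    proof (intro exI[of _ "\<lambda>t. norm \<beta> * k t"] conjI allI impI ballI)
      show "locally_integrable (\<lambda>t. norm \<beta> * k t)"
        using k(2) unfolding locally_integrable_def by (auto intro: set_integrable_mult_right)
      fix z :: complex and s t :: real assume "z \<in> K" and st: "0 \<le> s \<and> s \<le> t"
      then have "z \<in> unit_disk" using K by auto
      then have "norm (g s z - g t z) = norm \<beta> * norm (f s z - f t z)"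
        using g_affine st by (simp add: norm_mult[symmetric] right_diff_distrib)
      also have "\<dots> \<le> norm \<beta> * (LINT \<xi>:{s..t}|lebesgue. k \<xi>)"
        using k(3) \<open>z \<in> K\<close> st by (intro mult_left_mono) auto
      finally show "norm (g s z - g t z) \<le> (LINT \<xi>:{s..t}|lebesgue. norm \<beta> * k \<xi>)"
        by (simp add: set_integral_mult_right)
    qed (use k in auto)
  qed
  moreover have "inv_into unit_disk (g t) (g s z) = \<phi> s t z" if "0 \<le> s" "s \<le> t" "z \<in> unit_disk" for s t z
    using g_comp[OF that, symmetric] g_inj[of t] \<phi>_disk[OF that] that by (simp add: inv_into_f_f)
  ultimately show ?thesis
    unfolding loewner_chain_of_def using \<phi> by (intro conjI exI[of _ \<phi>] allI impI ballI) simp_all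
qed
end
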